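(* Let $f\in\mathcal{S}^*_{q}$ with $f(z)=z+\sum_{n=2}^{\infty}a_nz^n$. Then \begin{enumerate} \item[(i)] $|\sigma_3(f)(0)|\le 3$; \item[(ii)] $|\sigma_4(f)(0)|\le 16\sqrt{2/7}$. \end{enumerate} Both estimates are sharp. Equality in (i) is attained by the function $f_1\in\mathcal{S}^*_{q}$ (normalized by $f_1(0)=0$, $f_1'(0)=1$) corresponding to the Schwarz function $\omega(z)=z^2$, that is, $\dfrac{zf_1'(z)}{f_1(z)}=q(z^2)$. Equality in (ii) is attained by the function $f_2\in\mathcal{S}^*_{q}$ (normalized by $f_2(0)=0$, $f_2'(0)=1$) corresponding to the Schwarz function $$\omega_*(z)=z\left(\frac{\sqrt{2/7}+z}{1+\sqrt{2/7}\,z}\right),$$ that is, $\dfrac{zf_2'(z)}{f_2(z)}=q(\omega_*(z))$.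
   Context: Let $\mathbb{D}=\{z\in\mathbb{C}:|z|<1\}$. Let $\mathcal{A}$ be the class of analytic functions $f$ on $\mathbb{D}$ with $f(0)=0$, $f'(0)=1$, and let $\mathcal{S}\subset\mathcal{A}$ be the subclass of univalent (injective) functions. A Schwarz function is an analytic function $\omega$ on $\mathbb{D}$ with $\omega(0)=0$ and $|\omega(z)|<1$ for all $z\in\mathbb{D}$. For analytic functions $g,h$ on $\mathbb{D}$, $g\prec h$ ($g$ is subordinate to $h$) means $g(z)=h(\omega(z))$ on $\mathbb{D}$ for some Schwarz function $\omega$. Let $q(z)=z+\sqrt{1+z^2}$ for $z\in\mathbb{D}$ (principal branch of the square root, so $q(0)=1$). The lune-starlike class is $$\mathcal{S}^*_{q}=\left\{f\in\mathcal{S}:\frac{zf'(z)}{f(z)}\prec q(z)\right\},$$ where $zf'(z)/f(z)$ is given the value $1$ at $z=0$. For locally univalent $f$, the higher-order Schwarzian derivatives (Schippers functionals) are defined by $$\sigma_3(f)=\left(\frac{f''}{f'}\right)'-\frac12\left(\frac{f''}{f'}\right)^2,\qquad \sigma_{n+1}(f)=\sigma_n'(f)-(n-1)\,\sigma_n(f)\,\frac{f''}{f'}\quad(n\ge 3),$$ where $\sigma_n'(f)$ is the derivative in $z$ of $\sigma_n(f)$. For $f(z)=z+\sum_{n\ge2}a_nz^n$ one has $\sigma_3(f)(0)=6(a_3-a_2^2)$ and $\sigma_4(f)(0)=24(a_4-3a_2a_3+2a_2^3)$. *)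

theory Defs
  imports "HOL-Complex_Analysis.Complex_Analysis"
begin

abbreviation unit_disc :: "complex set" where
  "unit_disc \<equiv> ball 0 1"

text \<open>Functions on the disc are total functions of type complex to complex; only their values
  on the disc matter.\<close>

definition class_A :: "(complex \<Rightarrow> complex) set" where
  "class_A = {f. f holomorphic_on unit_disc \<and> f 0 = 0 \<and> deriv f 0 = 1}"

definition class_S :: "(complex \<Rightarrow> complex) set" where
  "class_S = {f \<in> class_A. inj_on f unit_disc}"

definition schwarz_function :: "(complex \<Rightarrow> complex) \<Rightarrow> bool" where
  "schwarz_function \<omega> \<longleftrightarrow>
     \<omega> holomorphic_on unit_disc \<and> \<omega> 0 = 0 \<and> (\<forall>z\<in>unit_disc. norm (\<omega> z) < 1)"

definition subordinate :: "(complex \<Rightarrow> complex) \<Rightarrow> (complex \<Rightarrow> complex) \<Rightarrow> bool"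
    (infix "\<prec>" 50) where
  "g \<prec> h \<longleftrightarrow> (\<exists>\<omega>. schwarz_function \<omega> \<and> (\<forall>z\<in>unit_disc. g z = h (\<omega> z)))"

definition lune :: "complex \<Rightarrow> complex" where
  "lune z = z + csqrt (1 + z\<^sup>2)"

text \<open>The quotient \<open>z f'(z) / f(z)\<close>, with its removable singularity at the origin filled in.\<close>

definition starlike_quotient :: "(complex \<Rightarrow> complex) \<Rightarrow> complex \<Rightarrow> complex" where
  "starlike_quotient f z = (if z = 0 then 1 else z * deriv f z / f z)"

definition lune_starlike :: "(complex \<Rightarrow> complex) set" where
  "lune_starlike = {f \<in> class_S. starlike_quotient f \<prec> lune}"

definition lune_corresponds ::
    "(complex \<Rightarrow> complex) \<Rightarrow> (complex \<Rightarrow> complex) \<Rightarrow> bool" where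
  "lune_corresponds f \<omega> \<longleftrightarrow>
     schwarz_function \<omega> \<and> (\<forall>z\<in>unit_disc. starlike_quotient f z = lune (\<omega> z))"

definition pre_schwarzian :: "(complex \<Rightarrow> complex) \<Rightarrow> complex \<Rightarrow> complex" where
  "pre_schwarzian f z = deriv (deriv f) z / deriv f z"

text \<open>The Schippers functionals are defined for orders at least 3, starting from the
  Schwarzian derivative; the value 0 at orders below 3 is a dummy.\<close>

primrec schippers :: "nat \<Rightarrow> (complex \<Rightarrow> complex) \<Rightarrow> complex \<Rightarrow> complex" where
  "schippers 0 f = (\<lambda>z. 0)"
| "schippers (Suc n) f =
     (if n < 2 then (\<lambda>z. 0)
      else if n = 2 then (\<lambda>z. deriv (pre_schwarzian f) z - (pre_schwarzian f z)\<^sup>2 / 2)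
      else (\<lambda>z. deriv (schippers n f) z
                - (of_nat n - 1) * schippers n f z * pre_schwarzian f z))"

end

theory Submission imports Defs
begin

text \<open>
  Let \<open>z f' / f = q(\<omega>)\<close> with a Schwarz function \<open>\<omega>(z) = c\<^sub>1 z + c\<^sub>2 z\<^sup>2 + c\<^sub>3 z\<^sup>3 + \<dots>\<close>. Since
  \<open>q(w) = 1 + w + w\<^sup>2 / 2 + O(w\<^sup>4)\<close>, comparison of coefficients turns the two functionals into
  \<open>3 (c\<^sub>2 - c\<^sub>1\<^sup>2 / 2)\<close> and \<open>8 (c\<^sub>3 - 2 c\<^sub>1 c\<^sub>2 + c\<^sub>1\<^sup>3 / 2)\<close> (\<open>schippers_lune_corresponds\<close>), so the
  theorem is about Schwarz functions.

  Schur's algorithm (\<open>schur_step\<close>) parametrises the coefficients as \<open>c\<^sub>1 = a\<close>,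
  \<open>c\<^sub>2 = (1 - |a|\<^sup>2) b\<close> and \<open>c\<^sub>3 = (1 - |a|\<^sup>2) ((1 - |b|\<^sup>2) d - cnj a b\<^sup>2)\<close>, with \<open>a\<close>, \<open>b\<close>, \<open>d\<close> in the
  closed disc. The first bound is then immediate. For the second, a rotation makes \<open>a = t\<close>
  non-negative and the triangle inequality in \<open>d\<close> leaves the maximum of
  \<open>t |(1 - t\<^sup>2) (b\<^sup>2 + 2 b) - t\<^sup>2 / 2| + (1 - t\<^sup>2) (1 - |b|\<^sup>2)\<close>. Dropping the phases before maximising would
  lose too much. The maximum is \<open>2 sqrt (2 / 7)\<close>, at \<open>t = sqrt (2 / 7)\<close> and \<open>b = 1\<close>
  (\<open>extremal_bound\<close>), which are the parameters of the Blaschke product \<open>\<omega>\<^sub>*\<close>.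

  For sharpness, every Schwarz function has to come from a univalent \<open>f\<close>. The function is found by
  integration (\<open>lune_starlike_exists\<close>). Its univalence follows from \<open>Re q > 0\<close>: in the
  coordinate \<open>\<zeta> = log z\<close> a logarithm of \<open>f\<close> has a derivative of positive real part on a half-plane and
  is therefore injective (\<open>starlike_imp_inj_on\<close>).
\<close>

text \<open>With the vector notation \<open>$\<close> also denotes components of vectors, which makes the
  coefficients of power series ambiguous.\<close>

unbundle no vec_syntax

section \<open>An extremal problem on the closed disc\<close>

text \<open>In the cases that stay away from the extremal point, this cruder rational bound is the one that
  is reached.\<close>

lemma extremal_value_ge: "17 / 16 \<le> 2 * sqrt (2 / 7 :: real)"
proof -
  have "(17 / 32 :: real) \<le> sqrt (2 / 7)"
    by (rule real_le_rsqrt) (simp add: power2_eq_square)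
  then show ?thesis by simp
qed

lemma cmod_quadratic_sq:
  fixes b :: complex and k m :: real
  shows "(cmod (k * b\<^sup>2 + 2 * k * b - m))\<^sup>2 =
     (k * (cmod b)\<^sup>2 + m)\<^sup>2 + 4 * k\<^sup>2 * (cmod b)\<^sup>2 + 4 * k * Re b * (k * (cmod b)\<^sup>2 - m)
       - 4 * k * m * (Re b)\<^sup>2"
  unfolding cmod_power2 by (simp add: power2_eq_square algebra_simps)

text \<open>The case of real \<open>b = r \<ge> 0\<close>. The left-hand side is a concave quadratic in \<open>r\<close> with vertex
  \<open>t / (1 - t)\<close>. For \<open>t \<le> 1 / 2\<close> the vertex lies in \<open>[0, 1]\<close> and the value there is
  \<open>1 + t\<^sup>3 / 2 \<le> 17 / 16\<close>. For \<open>t \<ge> 1 / 2\<close> the maximum on \<open>[0, 1]\<close> is at \<open>r = 1\<close>, and it equals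
  \<open>3 t - 7 t\<^sup>3 / 2\<close>, which is largest at \<open>t = sqrt (2 / 7)\<close>.\<close>

lemma extremal_bound_real:
  fixes t r :: real
  assumes "0 \<le> t" "t \<le> 1" "0 \<le> r" "r \<le> 1"
  shows "t * ((1 - t\<^sup>2) * (r\<^sup>2 + 2 * r) - t\<^sup>2 / 2) + (1 - t\<^sup>2) * (1 - r\<^sup>2) \<le> 2 * sqrt (2 / 7)"
    (is "?f \<le> _")
proof (cases "t \<le> 1 / 2")
  case True
  \<comment> \<open>completing the square at the vertex \<open>r = t / (1 - t)\<close>\<close>
  have "(1 - t) * (1 + t ^ 3 / 2 - ?f) = (1 - t\<^sup>2) * ((1 - t) * r - t)\<^sup>2"
    by (simp add: power2_eq_square power3_eq_cube algebra_simps add_divide_distrib)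
  also have "\<dots> \<ge> 0"
    using assms by (intro mult_nonneg_nonneg) (auto simp: abs_square_le_1)
  finally have "0 \<le> 1 + t ^ 3 / 2 - ?f"
    using True by (simp add: zero_le_mult_iff)
  moreover have "t ^ 3 \<le> (1 / 2) ^ 3"
    using assms True by (intro power_mono) auto
  ultimately show ?thesis
    using extremal_value_ge by (simp add: power_divide)
next
  case False
  define s :: real where "s = sqrt (2 / 7)"
  have s: "s\<^sup>2 = 2 / 7" "s \<ge> 0" by (auto simp: s_def)
  have "3 * t - 7 / 2 * t ^ 3 - ?f = (1 - t\<^sup>2) * (1 - r) * (t * (3 + r) - (1 + r))"
    by (simp add: power2_eq_square power3_eq_cube algebra_simps)
  moreover have "0 \<le> (1 - t\<^sup>2) * (1 - r) * (t * (3 + r) - (1 + r))"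
  proof -
    have "1 / 2 * (3 + r) \<le> t * (3 + r)"
      using False assms by (intro mult_right_mono) auto
    moreover have "1 + r \<le> 1 / 2 * (3 + r)" using assms by simp
    moreover have "0 \<le> 1 - t\<^sup>2" using assms by (simp add: power_le_one)
    ultimately show ?thesis
      using assms by (intro mult_nonneg_nonneg) linarith+
  qed
  ultimately have "?f \<le> 3 * t - 7 / 2 * t ^ 3" by linarith
  also have "\<dots> \<le> 2 * s"
  proof -
    \<comment> \<open>the cubic has a double root at \<open>s\<close>; the last summand vanishes since \<open>7 s\<^sup>2 = 2\<close>\<close>
    have "2 * s - (3 * t - 7 / 2 * t ^ 3) =
        7 / 2 * ((t - s)\<^sup>2 * (t + 2 * s)) + (3 * t - 2 * s) * (7 / 2 * s\<^sup>2 - 1)"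
      by (simp add: power2_eq_square power3_eq_cube field_simps)
    also have "\<dots> = 7 / 2 * ((t - s)\<^sup>2 * (t + 2 * s))"
      using s(1) by simp
    also have "\<dots> \<ge> 0"
      using s(2) assms by simp
    finally show ?thesis by simp
  qed
  finally show ?thesis by (simp add: s_def)
qed

text \<open>For fixed \<open>t\<close> and \<open>r = cmod b\<close>, the square of the modulus is a concave quadratic in \<open>x = Re b\<close>
  with vertex \<open>(k r\<^sup>2 - m) / (2 m)\<close>, where \<open>k = 1 - t\<^sup>2\<close> and \<open>m = t\<^sup>2 / 2\<close>. If the vertex is at least
  \<open>r\<close>, the worst \<open>b\<close> is the positive number \<open>r\<close>, which is the real case. If not, bounding the
  quadratic by its value at the vertex keeps the whole expression below \<open>17 / 16\<close>.\<close>

lemma extremal_bound: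
  fixes t :: real and b :: complex
  assumes t: "0 \<le> t" "t \<le> 1" and b: "cmod b \<le> 1"
  shows "t * cmod ((1 - t\<^sup>2) * b\<^sup>2 + 2 * (1 - t\<^sup>2) * b - t\<^sup>2 / 2) + (1 - t\<^sup>2) * (1 - (cmod b)\<^sup>2)
           \<le> 2 * sqrt (2 / 7)"
proof -
  define k m r x where "k = 1 - t\<^sup>2" and "m = t\<^sup>2 / 2" and "r = cmod b" and "x = Re b"
  define E where "E = cmod (k * b\<^sup>2 + 2 * k * b - m)"
  define z where "z = k * r\<^sup>2"
  have k: "0 \<le> k" "k \<le> 1" and m: "0 \<le> m" "m \<le> 1 / 2" and km: "k = 1 - 2 * m" "t\<^sup>2 = 2 * m"
    and r: "0 \<le> r" "r \<le> 1" and x: "\<bar>x\<bar> \<le> r"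
    using assms abs_Re_le_cmod[of b]
    by (auto simp: k_def m_def r_def x_def abs_square_le_1)
  have z: "0 \<le> z" "z \<le> k"
    using k r by (auto simp: z_def mult_le_cancel_left2 abs_square_le_1 power_le_one)
  have E: "E\<^sup>2 = (z + m)\<^sup>2 + 4 * k * z + k * (4 * x * (z - m) - 4 * m * x\<^sup>2)" "0 \<le> E"
    unfolding E_def cmod_quadratic_sq z_def r_def x_def
    by (auto simp: power2_eq_square algebra_simps)
  have "t * E + (k - z) \<le> 2 * sqrt (2 / 7)"
  proof (cases "z - m \<ge> 2 * m * r")
    case True
    have "0 \<le> k * (4 * (r - x) * ((z - m) - m * (r + x)))"
    proof -
      have "m * (r + x) \<le> m * (2 * r)"
        using x m by (intro mult_left_mono) auto
      then show ?thesis
        using True k x by (intro mult_nonneg_nonneg) auto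
    qed
    also have "\<dots> = (z + 2 * k * r - m)\<^sup>2 - E\<^sup>2"
      unfolding E z_def by (simp add: power2_eq_square algebra_simps)
    finally have "E\<^sup>2 \<le> (z + 2 * k * r - m)\<^sup>2" by simp
    moreover have "0 \<le> z + 2 * k * r - m"
    proof -
      have "0 \<le> 2 * m * r" "0 \<le> 2 * k * r" using m r k by auto
      then show ?thesis using True by linarith
    qed
    ultimately have "E \<le> z + 2 * k * r - m"
      by (rule power2_le_imp_le)
    then have "t * E \<le> t * (z + 2 * k * r - m)"
      using t by (intro mult_left_mono) auto
    moreover have "t * (z + 2 * k * r - m) + (k - z) \<le> 2 * sqrt (2 / 7)"
      using extremal_bound_real[OF t r]
      by (simp add: z_def k_def m_def algebra_simps)
    ultimately show ?thesis by linarith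
  next
    case False
    have "m * r \<le> m" using m r by (simp add: mult_le_cancel_left2)
    with False have z3: "z \<le> 3 * m" by linarith
    \<comment> \<open>The maximum over \<open>x\<close> is \<open>(z - m)\<^sup>2 / m\<close>. As \<open>z\<close> lies in \<open>[0, 3 m]\<close>, convexity bounds it by the
      chord \<open>m + z\<close>, which removes the denominator.\<close>
    have "4 * x * (z - m) - 4 * m * x\<^sup>2 \<le> m + z"
    proof (cases "m = 0")
      case True
      with z3 z show ?thesis by simp
    next
      case False
      have "m * (m + z - (4 * x * (z - m) - 4 * m * x\<^sup>2)) = (z - m - 2 * m * x)\<^sup>2 + z * (3 * m - z)"
        by (simp add: power2_eq_square algebra_simps)
      also have "\<dots> \<ge> 0"
        using z z3 by (intro add_nonneg_nonneg mult_nonneg_nonneg) auto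
      finally show ?thesis
        using False m by (simp add: zero_le_mult_iff)
    qed
    then have "E\<^sup>2 \<le> (z + m)\<^sup>2 + 4 * k * z + k * (m + z)"
      unfolding E using k by (simp add: mult_left_mono)
    then have "(t * E)\<^sup>2 \<le> 2 * m * ((z + m)\<^sup>2 + 4 * k * z + k * (m + z))"
      unfolding power_mult_distrib km(2) using m by (intro mult_left_mono) auto
    also have "\<dots> \<le> (1 / 16 + 2 * m + z)\<^sup>2"
    proof -
      \<comment> \<open>The term \<open>1 / 16\<close> is the room left by \<open>17 / 16 - (k - z) = 1 / 16 + 2 m + z\<close>.\<close>
      have "(1 / 16 + 2 * m + z)\<^sup>2 - 2 * m * ((z + m)\<^sup>2 + 4 * k * z + k * (m + z)) =
        (1 - 2 * m) * (z - 2 * m)\<^sup>2 + 8 * z * (m - 1 / 8)\<^sup>2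
          + m * (10 * (m - 1 / 10)\<^sup>2 + 3 / 20) + 1 / 256"
        unfolding km(1) by (simp add: power2_eq_square algebra_simps)
      also have "\<dots> \<ge> 0"
        using m z by (intro add_nonneg_nonneg mult_nonneg_nonneg) auto
      finally show ?thesis by simp
    qed
    finally have "t * E \<le> 1 / 16 + 2 * m + z"
      using m z by (intro power2_le_imp_le[of "t * E"]) auto
    then show ?thesis using extremal_value_ge km by linarith
  qed
  moreover have "(1 - t\<^sup>2) * (1 - (cmod b)\<^sup>2) = k - z"
    by (simp add: k_def z_def r_def algebra_simps)
  ultimately show ?thesis
    by (simp add: E_def k_def m_def)
qed

section \<open>Schur's algorithm and the first three coefficients of a Schwarz function\<close>

text \<open>The quotient \<open>g z / z\<close> with its removable singularity filled in.\<close>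

lemma holomorphic_factor_zero:
  assumes "g holomorphic_on unit_disc" "g 0 = 0"
  obtains h where "h holomorphic_on unit_disc" "\<And>z. g z = z * h z" "h 0 = deriv g 0"
proof
  let ?h = "\<lambda>z. if z = 0 then deriv g 0 else (g z - g 0) / (z - 0)"
  show "?h holomorphic_on unit_disc"
    using assms by (intro pole_lemma) (auto simp: interior_open)
  show "g z = z * ?h z" for z using assms by simp
qed simp

text \<open>One step of Schur's algorithm: if \<open>\<phi>\<close> is not constant, then the maximum principle gives
  \<open>cmod (\<phi> z) < 1\<close>, so \<open>\<phi>\<close> followed by the Moebius transformation that moves \<open>\<phi> 0\<close> to the
  origin satisfies the hypotheses of the Schwarz lemma, and \<open>\<kappa>\<close> is the quotient of this
  composition by \<open>z\<close>. The relation is stated without a denominator, so that it also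
  covers the constant functions of modulus one, with \<open>\<kappa> = 0\<close>.\<close>

lemma schur_step:
  assumes hol: "\<phi> holomorphic_on unit_disc" and le: "\<And>z. z \<in> unit_disc \<Longrightarrow> cmod (\<phi> z) \<le> 1"
  obtains \<kappa> where "\<kappa> holomorphic_on unit_disc" "\<And>z. z \<in> unit_disc \<Longrightarrow> cmod (\<kappa> z) \<le> 1"
    "\<And>z. z \<in> unit_disc \<Longrightarrow> \<phi> z - \<phi> 0 = z * \<kappa> z * (1 - cnj (\<phi> 0) * \<phi> z)"
proof (cases "\<phi> constant_on unit_disc")
  case True
  then obtain c where "\<And>z. z \<in> unit_disc \<Longrightarrow> \<phi> z = c"
    by (auto simp: constant_on_def)
  then show ?thesis
    by (intro that[of "\<lambda>_. 0"]) simp_all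
next
  case False
  have lt: "cmod (\<phi> z) < 1" if "z \<in> unit_disc" for z
  proof (rule ccontr)
    assume "\<not> cmod (\<phi> z) < 1"
    then have "cmod (\<phi> w) \<le> cmod (\<phi> z)" if "w \<in> unit_disc" for w
      using le[OF that] by linarith
    from maximum_modulus_principle[OF hol _ _ _ _ \<open>z \<in> unit_disc\<close> this] False
    show False by auto
  qed
  define a where "a = \<phi> 0"
  define \<psi> where "\<psi> z = Moebius_function 0 a (\<phi> z)" for z
  have a: "cmod a < 1" using lt[of 0] by (simp add: a_def)
  have "\<psi> holomorphic_on unit_disc"
    unfolding \<psi>_def using lt
    by (intro holomorphic_on_compose_gen[OF hol Moebius_function_holomorphic[OF a], unfolded o_def]) auto
  moreover have "\<psi> 0 = 0"
    by (simp add: \<psi>_def a_def Moebius_function_eq_zero)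
  moreover have \<psi>1: "cmod (\<psi> z) < 1" if "cmod z < 1" for z
    unfolding \<psi>_def using a lt that by (intro Moebius_function_norm_lt_1) auto
  ultimately have schwarz: "cmod (\<psi> z) \<le> cmod z" "cmod (deriv \<psi> 0) \<le> 1" if "cmod z < 1" for z
    using Schwarz_Lemma(1,2)[of \<psi> z] that by blast+
  obtain \<kappa> where \<kappa>: "\<kappa> holomorphic_on unit_disc" "\<And>z. \<psi> z = z * \<kappa> z" "\<kappa> 0 = deriv \<psi> 0"
    using holomorphic_factor_zero[OF \<open>\<psi> holomorphic_on unit_disc\<close> \<open>\<psi> 0 = 0\<close>] by blast
  show ?thesis
  proof
    fix z assume z: "z \<in> unit_disc"
    show "cmod (\<kappa> z) \<le> 1"
    proof (cases "z = 0")
      case True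
      then show ?thesis using \<kappa>(3) schwarz(2)[of 0] by simp
    next
      case False
      have "cmod z * cmod (\<kappa> z) \<le> cmod z * 1"
        using schwarz(1)[of z] z \<kappa>(2)[of z] by (simp add: norm_mult)
      then show ?thesis using False by simp
    qed
    have "cmod (cnj a * \<phi> z) < 1"
      using mult_strict_mono'[OF a lt[OF z]] by (simp add: norm_mult)
    then have "1 - cnj a * \<phi> z \<noteq> 0" by auto
    then show "\<phi> z - \<phi> 0 = z * \<kappa> z * (1 - cnj (\<phi> 0) * \<phi> z)"
      using \<kappa>(2)[of z] unfolding \<psi>_def Moebius_function_simple a_def[symmetric]
      by (metis nonzero_eq_divide_eq)
  qed (rule \<kappa>)
qed

lemma fps_mult_nth_2: "(A * B) $ 2 = A $ 0 * B $ 2 + A $ 1 * B $ 1 + A $ 2 * B $ 0"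
  for A B :: "'a::comm_ring_1 fps"
  by (simp add: fps_mult_nth numeral_2_eq_2 add_ac)

lemma fps_mult_nth_3:
  "(A * B) $ 3 = A $ 0 * B $ 3 + A $ 1 * B $ 2 + A $ 2 * B $ 1 + A $ 3 * B $ 0"
  for A B :: "'a::comm_ring_1 fps"
  by (simp add: fps_mult_nth eval_nat_numeral add_ac)

lemma fps_mult_nth_4:
  "(A * B) $ 4 = A $ 0 * B $ 4 + A $ 1 * B $ 3 + A $ 2 * B $ 2 + A $ 3 * B $ 1 + A $ 4 * B $ 0"
  for A B :: "'a::comm_ring_1 fps"
  by (simp add: fps_mult_nth eval_nat_numeral add_ac)

lemma fps_deriv_nth_small:
  fixes F :: "complex fps"
  shows "fps_deriv F $ 0 = F $ 1" "fps_deriv F $ 1 = 2 * F $ 2"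
    "fps_deriv F $ 2 = 3 * F $ 3" "fps_deriv F $ 3 = 4 * F $ 4"
  by (simp_all add: eval_nat_numeral)

lemma holomorphic_disc_has_fps_expansion:
  "g holomorphic_on unit_disc \<Longrightarrow> g has_fps_expansion fps_expansion g 0"
  by (rule has_fps_expansion_fps_expansion[of unit_disc]) auto

lemma has_fps_expansion_unique_disc:
  assumes "f has_fps_expansion F" "g has_fps_expansion G"
    "\<And>z. z \<in> unit_disc \<Longrightarrow> f z = g z"
  shows "F = G"
proof -
  have "\<forall>\<^sub>F z in nhds 0. f z = g z"
    using eventually_nhds_in_open[of unit_disc 0] by (rule eventually_mono) (auto simp: assms(3))
  then have "f has_fps_expansion G"
    using assms(2) has_fps_expansion_cong by blast
  then show ?thesis
    using assms(1) fps_expansion_unique_complex by blast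
qed

text \<open>Comparison of coefficients in the Schur step expresses the Taylor coefficients of \<open>\<phi>\<close>
  through those of the next function, which is again bounded by one.\<close>

lemma schur_coefficients:
  assumes hol: "\<phi> holomorphic_on unit_disc" and le: "\<And>z. z \<in> unit_disc \<Longrightarrow> cmod (\<phi> z) \<le> 1"
    and P: "\<phi> has_fps_expansion P"
  obtains \<kappa> X where "\<kappa> holomorphic_on unit_disc" "\<And>z. z \<in> unit_disc \<Longrightarrow> cmod (\<kappa> z) \<le> 1"
    "\<kappa> has_fps_expansion X"
    "P $ 1 = X $ 0 * (1 - cnj (P $ 0) * P $ 0)"
    "P $ 2 = X $ 1 * (1 - cnj (P $ 0) * P $ 0) - X $ 0 * cnj (P $ 0) * P $ 1"
    "P $ 3 = X $ 2 * (1 - cnj (P $ 0) * P $ 0) - X $ 1 * cnj (P $ 0) * P $ 1 - X $ 0 * cnj (P $ 0) * P $ 2"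
proof -
  obtain \<kappa> where \<kappa>: "\<kappa> holomorphic_on unit_disc" "\<And>z. z \<in> unit_disc \<Longrightarrow> cmod (\<kappa> z) \<le> 1"
    "\<And>z. z \<in> unit_disc \<Longrightarrow> \<phi> z - \<phi> 0 = z * \<kappa> z * (1 - cnj (\<phi> 0) * \<phi> z)"
    using schur_step[OF hol le] by blast
  define X where "X = fps_expansion \<kappa> 0"
  have X: "\<kappa> has_fps_expansion X"
    using \<kappa>(1) unfolding X_def by (rule holomorphic_disc_has_fps_expansion)
  have P0: "\<phi> 0 = P $ 0"
    using P by (rule has_fps_expansion_imp_0_eq_fps_nth_0)
  have "P - fps_const (\<phi> 0) = fps_X * (X * (1 - fps_const (cnj (\<phi> 0)) * P))"
  proof (rule has_fps_expansion_unique_disc)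
    show "(\<lambda>z. \<phi> z - \<phi> 0) has_fps_expansion P - fps_const (\<phi> 0)"
      by (intro fps_expansion_intros P)
    show "(\<lambda>z. z * (\<kappa> z * (1 - cnj (\<phi> 0) * \<phi> z)))
            has_fps_expansion fps_X * (X * (1 - fps_const (cnj (\<phi> 0)) * P))"
      by (intro fps_expansion_intros P X)
  qed (use \<kappa>(3) in \<open>simp add: mult.assoc\<close>)
  then have eq: "fps_nth (P - fps_const (\<phi> 0)) n =
      fps_nth (fps_X * (X * (1 - fps_const (cnj (\<phi> 0)) * P))) n" for n
    by simp
  show ?thesis
    using that[OF \<kappa>(1,2) X] eq[of 1] eq[of 2] eq[of 3]
    by (simp add: P0 fps_mult_nth_2 algebra_simps)
qed

text \<open>Three Schur steps, beginning with \<open>\<omega>\<close> itself; \<open>W $ 1\<close>, \<open>b\<close> and \<open>d\<close> are the first three Schur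
  parameters of \<open>\<omega> z / z\<close>.\<close>

lemma schwarz_function_coefficients:
  assumes "schwarz_function \<omega>" "\<omega> has_fps_expansion W"
  obtains b d where "cmod (W $ 1) \<le> 1" "cmod b \<le> 1" "cmod d \<le> 1"
    "W $ 2 = of_real (1 - (cmod (W $ 1))\<^sup>2) * b"
    "W $ 3 = of_real (1 - (cmod (W $ 1))\<^sup>2) * (of_real (1 - (cmod b)\<^sup>2) * d - cnj (W $ 1) * b\<^sup>2)"
proof -
  have hol: "\<omega> holomorphic_on unit_disc"
    using assms by (simp add: schwarz_function_def)
  have le: "cmod (\<omega> z) \<le> 1" if "z \<in> unit_disc" for z
    using assms that by (force simp: schwarz_function_def)
  have W0: "W $ 0 = 0"
    using assms has_fps_expansion_imp_0_eq_fps_nth_0[OF assms(2)] by (simp add: schwarz_function_def)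
  have sq: "1 - cnj w * w = of_real (1 - (cmod w)\<^sup>2)" for w
    by (simp only: of_real_diff of_real_1 complex_norm_square mult.commute)
  have le0: "cmod (X $ 0) \<le> 1"
    if "\<kappa> has_fps_expansion X" "\<And>z. z \<in> unit_disc \<Longrightarrow> cmod (\<kappa> z) \<le> 1" for \<kappa> X
    using that(2)[of 0] has_fps_expansion_imp_0_eq_fps_nth_0[OF that(1)] by simp
  obtain \<phi> P where \<phi>: "\<phi> holomorphic_on unit_disc" "\<And>z. z \<in> unit_disc \<Longrightarrow> cmod (\<phi> z) \<le> 1"
      "\<phi> has_fps_expansion P" and W: "W $ 1 = P $ 0" "W $ 2 = P $ 1" "W $ 3 = P $ 2"
    by (rule schur_coefficients[OF _ _ assms(2)]) (use hol le W0 in simp_all)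
  obtain \<kappa> X where \<kappa>: "\<kappa> holomorphic_on unit_disc" "\<And>z. z \<in> unit_disc \<Longrightarrow> cmod (\<kappa> z) \<le> 1"
      "\<kappa> has_fps_expansion X"
    and P: "P $ 1 = X $ 0 * (1 - cnj (P $ 0) * P $ 0)"
    "P $ 2 = X $ 1 * (1 - cnj (P $ 0) * P $ 0) - X $ 0 * cnj (P $ 0) * P $ 1"
    using schur_coefficients[OF \<phi>] by metis
  obtain \<xi> Y where \<xi>: "\<And>z. z \<in> unit_disc \<Longrightarrow> cmod (\<xi> z) \<le> 1" "\<xi> has_fps_expansion Y"
    and X: "X $ 1 = Y $ 0 * (1 - cnj (X $ 0) * X $ 0)"
    using schur_coefficients[OF \<kappa>] by metis
  show ?thesis
  proof (rule that[of "X $ 0" "Y $ 0"])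
    show "cmod (W $ 1) \<le> 1" "cmod (X $ 0) \<le> 1" "cmod (Y $ 0) \<le> 1"
      unfolding W using le0[OF \<phi>(3,2)] le0[OF \<kappa>(3,2)] le0[OF \<xi>(2,1)] by blast+
    show "W $ 2 = of_real (1 - (cmod (W $ 1))\<^sup>2) * X $ 0"
      unfolding W P sq by simp
    show "W $ 3 = of_real (1 - (cmod (W $ 1))\<^sup>2) *
        (of_real (1 - (cmod (X $ 0))\<^sup>2) * Y $ 0 - cnj (W $ 1) * (X $ 0)\<^sup>2)"
      unfolding W P X sq by (simp add: power2_eq_square algebra_simps)
  qed
qed

lemma schwarz_second_coefficient_bound:
  assumes "schwarz_function \<omega>" "\<omega> has_fps_expansion W"
  shows "cmod (W $ 2 - (W $ 1)\<^sup>2 / 2) \<le> 1"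
proof -
  obtain b where b: "cmod (W $ 1) \<le> 1" "cmod b \<le> 1"
    and W2: "W $ 2 = of_real (1 - (cmod (W $ 1))\<^sup>2) * b"
    using schwarz_function_coefficients[OF assms] by metis
  have 1: "0 \<le> 1 - (cmod (W $ 1))\<^sup>2"
    using b by (simp add: power_le_one)
  have "cmod (W $ 2 - (W $ 1)\<^sup>2 / 2) \<le> cmod (W $ 2) + cmod ((W $ 1)\<^sup>2 / 2)"
    by (rule norm_triangle_ineq4)
  also have "\<dots> = (1 - (cmod (W $ 1))\<^sup>2) * cmod b + (cmod (W $ 1))\<^sup>2 / 2"
    unfolding W2 norm_mult norm_of_real using 1 by (simp add: norm_divide norm_power)
  also have "\<dots> \<le> (1 - (cmod (W $ 1))\<^sup>2) * 1 + (cmod (W $ 1))\<^sup>2 / 2"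
    using b 1 by (intro add_right_mono mult_left_mono) auto
  also have "\<dots> \<le> 1" by simp
  finally show ?thesis .
qed

text \<open>In terms of the Schur parameters \<open>t u\<close> (with \<open>u\<close> of modulus one), \<open>b\<close> and \<open>d\<close>, writing
  \<open>b = v u\<^sup>2\<close> makes every term without \<open>d\<close> a multiple of \<open>u\<^sup>3\<close>. The triangle inequality,
  which is sharp in \<open>d\<close>, then leaves exactly the expression treated in the extremal problem.\<close>

lemma schwarz_third_coefficient_bound:
  assumes "schwarz_function \<omega>" "\<omega> has_fps_expansion W"
  shows "cmod (W $ 3 - 2 * W $ 1 * W $ 2 + (W $ 1) ^ 3 / 2) \<le> 2 * sqrt (2 / 7)"
proof -
  obtain b d where b: "cmod (W $ 1) \<le> 1" "cmod b \<le> 1" and d: "cmod d \<le> 1"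
    and W2: "W $ 2 = of_real (1 - (cmod (W $ 1))\<^sup>2) * b"
    and W3: "W $ 3 = of_real (1 - (cmod (W $ 1))\<^sup>2) *
              (of_real (1 - (cmod b)\<^sup>2) * d - cnj (W $ 1) * b\<^sup>2)"
    using schwarz_function_coefficients[OF assms] by metis
  define t u where "t = cmod (W $ 1)" and "u = cis (Arg (W $ 1))"
  define k where "k = 1 - t\<^sup>2"
  define v where "v = b * (cnj u)\<^sup>2"
  have W1: "W $ 1 = t * u"
    using cis_Arg by (simp add: t_def u_def rcis_cmod_Arg flip: rcis_def)
  have u: "cmod u = 1" "cnj u * u = 1"
    by (simp_all add: u_def cis_mult cis_cnj)
  have bv: "b = v * u\<^sup>2"
  proof -
    have "v * u\<^sup>2 = b * (cnj u * u)\<^sup>2"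
      by (simp add: v_def power_mult_distrib mult.assoc)
    then show ?thesis using u by simp
  qed
  have v: "cmod v = cmod b"
    using u by (simp add: v_def norm_mult norm_power)
  have t: "0 \<le> t" "t \<le> 1" using b by (simp_all add: t_def)
  have k: "0 \<le> k" using b by (simp add: k_def t_def power_le_one)
  have uu: "cnj u * u ^ 4 = u ^ 3"
  proof -
    have "cnj u * u ^ 4 = (cnj u * u) * u ^ 3"
      by (simp add: eval_nat_numeral)
    then show ?thesis using u by simp
  qed
  have "W $ 3 - 2 * W $ 1 * W $ 2 + (W $ 1) ^ 3 / 2 =
      k * (1 - (cmod b)\<^sup>2) * d - t * k * (cnj u * u ^ 4) * v\<^sup>2 - 2 * t * k * u ^ 3 * v + t ^ 3 * u ^ 3 / 2"
    unfolding W3 W2 unfolding k_def t_def[symmetric] unfolding W1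
    by (subst (2 3) bv) (simp add: eval_nat_numeral algebra_simps)
  also have "\<dots> = of_real (k * (1 - (cmod b)\<^sup>2)) * d
      - of_real t * u ^ 3 * (k * v\<^sup>2 + 2 * k * v - t\<^sup>2 / 2)"
    unfolding uu by (simp add: eval_nat_numeral algebra_simps)
  also have "cmod \<dots> \<le> cmod (of_real (k * (1 - (cmod b)\<^sup>2)) * d)
      + cmod (of_real t * u ^ 3 * (k * v\<^sup>2 + 2 * k * v - t\<^sup>2 / 2))"
    by (rule norm_triangle_ineq4)
  also have "cmod (of_real (k * (1 - (cmod b)\<^sup>2)) * d) = k * (1 - (cmod b)\<^sup>2) * cmod d"
    unfolding norm_mult norm_of_real using k b by (simp add: power_le_one abs_mult)
  also have "\<dots> \<le> k * (1 - (cmod b)\<^sup>2) * 1"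
    using k b d by (intro mult_left_mono) (auto simp: power_le_one)
  also have "cmod (of_real t * u ^ 3 * (k * v\<^sup>2 + 2 * k * v - t\<^sup>2 / 2)) =
      t * cmod (k * v\<^sup>2 + 2 * k * v - t\<^sup>2 / 2)"
    by (simp add: norm_mult norm_power u t_def)
  also have "k * (1 - (cmod b)\<^sup>2) * 1 + t * cmod (k * v\<^sup>2 + 2 * k * v - t\<^sup>2 / 2) \<le> 2 * sqrt (2 / 7)"
    using extremal_bound[OF t, of v] b v by (simp add: k_def add.commute)
  finally show ?thesis by simp
qed

section \<open>The lune function and the Schippers functionals at the origin\<close>

lemma Re_one_plus_square_pos:
  assumes "cmod w < 1"
  shows "0 < Re (1 + w\<^sup>2)"
proof -
  have "(cmod w)\<^sup>2 < 1" using assms by (simp add: abs_square_less_1)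
  then show ?thesis by (simp add: cmod_power2 Re_power2) (smt (verit) zero_le_power2)
qed

text \<open>If \<open>s\<close> is the square root, then \<open>s\<^sup>2 - w\<^sup>2 = 1\<close>; comparing real parts,
  \<open>(Re s)\<^sup>2 - (Re w)\<^sup>2 = 1 + (Im s)\<^sup>2 - (Im w)\<^sup>2 > 0\<close>, so \<open>Re s\<close> dominates \<open>Re w\<close>.\<close>

lemma Re_lune_pos:
  assumes "cmod w < 1"
  shows "0 < Re (lune w)"
proof -
  define s where "s = csqrt (1 + w\<^sup>2)"
  have s0: "0 \<le> Re s" using csqrt_principal[of "1 + w\<^sup>2"] by (auto simp: s_def)
  have "s\<^sup>2 = 1 + w\<^sup>2" by (simp add: s_def)
  then have eq: "(Re s)\<^sup>2 - (Im s)\<^sup>2 = 1 + (Re w)\<^sup>2 - (Im w)\<^sup>2"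
    by (simp add: complex_eq_iff Re_power2)
  have "(Im w)\<^sup>2 < 1"
    using assms by (simp add: abs_square_less_1) (meson abs_Im_le_cmod le_less_trans)
  with eq have "\<bar>Re w\<bar>\<^sup>2 < (Re s)\<^sup>2" 
    by (simp) (smt (verit) zero_le_power2)
  then have "\<bar>Re w\<bar> < Re s"
    using s0 by (rule power_less_imp_less_base)
  then show ?thesis by (simp add: lune_def s_def)
qed

lemma holomorphic_on_lune: "lune holomorphic_on unit_disc"
proof -
  have "1 + w\<^sup>2 \<notin> \<real>\<^sub>\<le>\<^sub>0" if "w \<in> unit_disc" for w
    using Re_one_plus_square_pos[of w] that by (auto simp: complex_nonpos_Reals_iff)
  then show ?thesis
    unfolding lune_def by (intro holomorphic_intros) auto
qed

lemma lune_0 [simp]: "lune 0 = 1"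
  by (simp add: lune_def)

text \<open>The square root \<open>s\<close> of \<open>1 + \<omega>\<^sup>2\<close> is determined, as a power series, by \<open>s\<^sup>2 = 1 + \<omega>\<^sup>2\<close> and
  \<open>s 0 = 1\<close>.\<close>

lemma lune_fps:
  assumes "schwarz_function \<omega>" "\<omega> has_fps_expansion W"
  obtains P where "(\<lambda>z. lune (\<omega> z)) has_fps_expansion P"
    "P $ 0 = 1" "P $ 1 = W $ 1" "P $ 2 = W $ 2 + (W $ 1)\<^sup>2 / 2" "P $ 3 = W $ 3 + W $ 1 * W $ 2"
proof -
  define s where "s z = csqrt (1 + (\<omega> z)\<^sup>2)" for z
  have \<omega>: "\<omega> holomorphic_on unit_disc" "\<omega> 0 = 0" "\<And>z. z \<in> unit_disc \<Longrightarrow> cmod (\<omega> z) < 1"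
    using assms by (auto simp: schwarz_function_def)
  have "1 + (\<omega> z)\<^sup>2 \<notin> \<real>\<^sub>\<le>\<^sub>0" if "z \<in> unit_disc" for z
    using Re_one_plus_square_pos[OF \<omega>(3)[OF that]] by (auto simp: complex_nonpos_Reals_iff)
  then have "s holomorphic_on unit_disc"
    unfolding s_def using \<omega> by (intro holomorphic_intros) auto
  then have S: "s has_fps_expansion fps_expansion s 0" (is "_ has_fps_expansion ?S")
    by (rule holomorphic_disc_has_fps_expansion)
  have W0: "W $ 0 = 0"
    using has_fps_expansion_imp_0_eq_fps_nth_0[OF assms(2)] \<omega> by simp
  have S0: "?S $ 0 = 1"
    using has_fps_expansion_imp_0_eq_fps_nth_0[OF S] \<omega> by (simp add: s_def)
  have eq: "?S * ?S = 1 + W * W"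
  proof (rule has_fps_expansion_unique_disc)
    show "(\<lambda>z. s z * s z) has_fps_expansion ?S * ?S"
      by (intro fps_expansion_intros S)
    show "(\<lambda>z. 1 + \<omega> z * \<omega> z) has_fps_expansion 1 + W * W"
      by (intro fps_expansion_intros assms)
    show "s z * s z = 1 + \<omega> z * \<omega> z" for z
      using power2_csqrt[of "1 + (\<omega> z)\<^sup>2"] by (simp add: s_def power2_eq_square)
  qed
  have eqn: "fps_nth (?S * ?S) n = fps_nth (1 + W * W) n" for n
    by (simp add: eq)
  have S1: "?S $ 1 = 0" using eqn[of 1] W0 S0 by simp
  have S2: "?S $ 2 = (W $ 1)\<^sup>2 / 2"
    using eqn[of 2] W0 S0 S1 by (simp add: fps_mult_nth_2 power2_eq_square mult.commute)
  have S3: "?S $ 3 = W $ 1 * W $ 2"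
    using eqn[of 3] W0 S0 S1 S2 by (simp add: fps_mult_nth_3)
  show ?thesis
  proof
    show "(\<lambda>z. lune (\<omega> z)) has_fps_expansion W + ?S"
      unfolding lune_def s_def[symmetric] by (intro fps_expansion_intros assms S)
  qed (use W0 S0 S1 S2 S3 in auto)
qed

text \<open>The differential equation without denominators. A zero of \<open>f\<close> away from the origin would make
  the quotient zero, since division by zero gives zero, but the lune function has no zero.\<close>

lemma starlike_equation:
  assumes f: "f \<in> class_A" and c: "lune_corresponds f \<omega>" and z: "z \<in> unit_disc"
  shows "z * deriv f z = f z * lune (\<omega> z)"
proof (cases "z = 0")
  case True
  then show ?thesis using f by (simp add: class_A_def)
next
  case False
  have "cmod (\<omega> z) < 1" and "starlike_quotient f z = lune (\<omega> z)"
    using c z unfolding lune_corresponds_def schwarz_function_def by blast+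
  then have eq: "z * deriv f z / f z = lune (\<omega> z)" and "lune (\<omega> z) \<noteq> 0"
    using False Re_lune_pos[of "\<omega> z"] by (auto simp: starlike_quotient_def)
  then show ?thesis by (cases "f z = 0") (auto simp: field_simps)
qed

text \<open>The expansion of \<open>f'' / f'\<close> is the quotient of the formal derivatives, so its coefficients
  follow recursively from those of \<open>f\<close>, and the functionals are polynomials in them.\<close>

lemma schippers_at_0:
  assumes F: "f has_fps_expansion F" and F1: "F $ 1 = 1"
  shows "schippers 3 f 0 = 6 * (F $ 3 - (F $ 2)\<^sup>2)"
    and "schippers 4 f 0 = 24 * (F $ 4 - 3 * F $ 2 * F $ 3 + 2 * (F $ 2) ^ 3)"
proof -
  define N where "N = fps_deriv (fps_deriv F) / fps_deriv F"
  have nz: "fps_nth (fps_deriv F) 0 \<noteq> 0" using F1 by simp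
  have N: "pre_schwarzian f has_fps_expansion N"
    unfolding N_def pre_schwarzian_def using nz by (intro fps_expansion_intros F)
  have "N * fps_deriv F = fps_deriv (fps_deriv F)"
    using nz by (simp add: N_def fps_divide_unit mult.assoc inverse_mult_eq_1)
  then have eq: "fps_nth (N * fps_deriv F) n = fps_nth (fps_deriv (fps_deriv F)) n" for n
    by simp
  have N0: "N $ 0 = 2 * F $ 2"
    using eq[of 0] F1 by (simp add: fps_deriv_nth_small del: fps_deriv_nth One_nat_def)
  have N1: "N $ 1 = 6 * F $ 3 - 4 * (F $ 2)\<^sup>2"
    using eq[of 1] F1 N0
    by (simp add: fps_deriv_nth_small fps_mult_nth_1 power2_eq_square algebra_simps
        del: fps_deriv_nth One_nat_def)
  have "N $ 2 + N $ 1 * (2 * F $ 2) + N $ 0 * (3 * F $ 3) = 12 * F $ 4"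
    using eq[of 2] F1
    by (simp add: fps_deriv_nth_small fps_mult_nth_2 algebra_simps del: fps_deriv_nth One_nat_def)
  then have "N $ 2 = 12 * F $ 4 - (N $ 1 * (2 * F $ 2) + N $ 0 * (3 * F $ 3))"
    by (simp only: eq_diff_eq add.assoc)
  then have N2: "N $ 2 = 12 * F $ 4 - 18 * F $ 2 * F $ 3 + 8 * (F $ 2) ^ 3"
    unfolding N0 N1 by (simp add: power2_eq_square power3_eq_cube algebra_simps)
  have s3: "schippers 3 f = (\<lambda>z. deriv (pre_schwarzian f) z - 1 / 2 * (pre_schwarzian f z)\<^sup>2)"
    by (simp add: eval_nat_numeral)
  have s4: "schippers 4 f = (\<lambda>z. deriv (schippers 3 f) z - 2 * schippers 3 f z * pre_schwarzian f z)"
    by (simp add: eval_nat_numeral)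
  define S where "S = fps_deriv N - fps_const (1 / 2) * N ^ 2"
  have S: "schippers 3 f has_fps_expansion S"
    unfolding s3 S_def by (intro fps_expansion_intros N)
  have S': "schippers 4 f has_fps_expansion fps_deriv S - fps_const 2 * S * N"
    unfolding s4 by (intro fps_expansion_intros N S)
  have S0: "S $ 0 = N $ 1 - 1 / 2 * (N $ 0)\<^sup>2"
    by (simp add: S_def power2_eq_square)
  have S1: "S $ 1 = 2 * N $ 2 - N $ 0 * N $ 1"
    by (simp add: S_def fps_deriv_nth_small power2_eq_square fps_mult_nth_1 del: fps_deriv_nth One_nat_def)
  show "schippers 3 f 0 = 6 * (F $ 3 - (F $ 2)\<^sup>2)"
    unfolding has_fps_expansion_imp_0_eq_fps_nth_0[OF S] S0 N0 N1
    by (simp add: power2_eq_square)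
  have "schippers 4 f 0 = S $ 1 - 2 * S $ 0 * N $ 0"
    unfolding has_fps_expansion_imp_0_eq_fps_nth_0[OF S'] by simp
  then show "schippers 4 f 0 = 24 * (F $ 4 - 3 * F $ 2 * F $ 3 + 2 * (F $ 2) ^ 3)"
    unfolding S0 S1 N0 N1 N2 by (simp add: power2_eq_square power3_eq_cube algebra_simps)
qed

text \<open>The equation \<open>z f' = f q(\<omega>)\<close> determines the coefficients of \<open>f\<close> recursively from those of \<open>\<omega>\<close>.\<close>

lemma schippers_lune_corresponds:
  assumes f: "f \<in> class_A" and c: "lune_corresponds f \<omega>" and W: "\<omega> has_fps_expansion W"
  shows "schippers 3 f 0 = 3 * (W $ 2 - (W $ 1)\<^sup>2 / 2)"
    and "schippers 4 f 0 = 8 * (W $ 3 - 2 * W $ 1 * W $ 2 + (W $ 1) ^ 3 / 2)"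
proof -
  define F where "F = fps_expansion f 0"
  have F: "f has_fps_expansion F"
    using f unfolding F_def by (intro holomorphic_disc_has_fps_expansion) (simp add: class_A_def)
  obtain P where P: "(\<lambda>z. lune (\<omega> z)) has_fps_expansion P"
    and Pn: "P $ 0 = 1" "P $ 1 = W $ 1" "P $ 2 = W $ 2 + (W $ 1)\<^sup>2 / 2" "P $ 3 = W $ 3 + W $ 1 * W $ 2"
    using lune_fps c W unfolding lune_corresponds_def by metis
  have F0: "F $ 0 = 0"
    using f has_fps_expansion_imp_0_eq_fps_nth_0[OF F] by (simp add: class_A_def)
  have F1: "F $ 1 = 1"
    using f has_fps_expansion_imp_0_eq_fps_nth_0[OF has_fps_expansion_deriv[OF F]]
    by (simp add: class_A_def)
  have "fps_X * fps_deriv F = F * P"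
    by (rule has_fps_expansion_unique_disc[of "\<lambda>z. z * deriv f z" _ "\<lambda>z. f z * lune (\<omega> z)"])
      (use starlike_equation[OF f c] in \<open>auto intro!: fps_expansion_intros F P\<close>)
  then have eq: "fps_nth (fps_X * fps_deriv F) n = fps_nth (F * P) n" for n by simp
  have "2 * F $ 2 = P $ 1 + F $ 2"
    using eq[of 2] F0 F1 Pn(1)
    by (simp add: fps_deriv_nth_small fps_mult_nth_2 del: fps_deriv_nth One_nat_def)
  then have F2: "F $ 2 = W $ 1"
    unfolding Pn by simp
  have "3 * F $ 3 = P $ 2 + F $ 2 * P $ 1 + F $ 3"
    using eq[of 3] F0 F1 Pn(1)
    by (simp add: fps_deriv_nth_small fps_mult_nth_3 del: fps_deriv_nth One_nat_def)
  then have a3: "F $ 3 = (P $ 2 + F $ 2 * P $ 1) / 2"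
    by (simp add: field_simps)
  have F3: "F $ 3 = W $ 2 / 2 + 3 / 4 * (W $ 1)\<^sup>2"
    unfolding a3 Pn F2 by (simp add: power2_eq_square field_simps)
  have "4 * F $ 4 = P $ 3 + F $ 2 * P $ 2 + F $ 3 * P $ 1 + F $ 4"
    using eq[of 4] F0 F1 Pn(1)
    by (simp add: fps_deriv_nth_small fps_mult_nth_4 del: fps_deriv_nth One_nat_def)
  then have a4: "F $ 4 = (P $ 3 + F $ 2 * P $ 2 + F $ 3 * P $ 1) / 3"
    by (simp add: field_simps)
  have F4: "F $ 4 = W $ 3 / 3 + 5 / 6 * W $ 1 * W $ 2 + 5 / 12 * (W $ 1) ^ 3"
    unfolding a4 Pn F2 F3 by (simp add: power2_eq_square power3_eq_cube field_simps)
  show "schippers 3 f 0 = 3 * (W $ 2 - (W $ 1)\<^sup>2 / 2)"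
    "schippers 4 f 0 = 8 * (W $ 3 - 2 * W $ 1 * W $ 2 + (W $ 1) ^ 3 / 2)"
    unfolding schippers_at_0[OF F F1] F2 F3 F4
    by (simp_all add: field_simps power2_eq_square power3_eq_cube)
qed

section \<open>Functions with a prescribed Schwarz function\<close>

text \<open>The Noshiro--Warschawski theorem: along the segment from \<open>a\<close> to \<open>b\<close>, the function
  \<open>Re (f / (b - a))\<close> has the positive derivative \<open>Re f'\<close>, so it takes different values at the ends.\<close>

lemma injective_on_convex_if_Re_deriv_pos:
  assumes S: "convex S" and d: "\<And>z. z \<in> S \<Longrightarrow> (f has_field_derivative f' z) (at z)"
    and pos: "\<And>z. z \<in> S \<Longrightarrow> 0 < Re (f' z)"
  shows "inj_on f S"
proof (rule inj_onI, rule ccontr)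
  fix a b assume ab: "a \<in> S" "b \<in> S" "f a = f b" "a \<noteq> b"
  define p where "p x = a + of_real x * (b - a)" for x :: real
  define g where "g x = Re (f (p x) / (b - a))" for x
  have "g 0 < g 1"
  proof (rule DERIV_pos_imp_increasing[where f = g])
    fix x :: real assume x: "0 \<le> x" "x \<le> 1"
    have p: "p x \<in> S"
      using convexD_alt[OF S ab(1,2), of x] x by (simp add: p_def scaleR_conv_of_real algebra_simps)
    have "((\<lambda>w. f (a + w * (b - a)) / (b - a)) has_field_derivative f' (p x)) (at (of_real x))"
      using ab(4) by (auto intro!: derivative_eq_intros 
          DERIV_chain2[where g = "\<lambda>w. a + w * (b - a)", OF d[OF p, unfolded p_def]] simp: p_def)
    then have "((\<lambda>x. f (p x) / (b - a)) has_vector_derivative f' (p x)) (at x)"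
      unfolding p_def using has_vector_derivative_real_field by blast
    then have "(g has_real_derivative Re (f' (p x))) (at x)"
      unfolding g_def has_real_derivative_iff_has_vector_derivative
      using bounded_linear.has_vector_derivative[OF bounded_linear_Re] by blast
    then show "\<exists>y. (g has_real_derivative y) (at x) \<and> 0 < y"
      using pos[OF p] by blast
  qed simp
  then show False using ab by (simp add: g_def p_def)
qed

text \<open>Univalence of starlike functions by a logarithmic change of variable. The map
  \<open>L \<zeta> = \<zeta> + h (exp \<zeta>)\<close> is, on the left half-plane, a logarithm of \<open>f (exp \<zeta>)\<close> with
  \<open>f z = z exp (h z)\<close>, and its derivative is \<open>z f' z / f z\<close> at \<open>z = exp \<zeta>\<close>. It is injective because the half-plane is convex, and it
  commutes with translation by \<open>2 pi \<i>\<close>; hence equal values of \<open>f\<close> come from equal points.\<close>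

lemma starlike_imp_inj_on:
  assumes h: "\<And>z. z \<in> unit_disc \<Longrightarrow> (h has_field_derivative h' z) (at z)"
    and pos: "\<And>z. z \<in> unit_disc \<Longrightarrow> 0 < Re (1 + z * h' z)"
  shows "inj_on (\<lambda>z. z * exp (h z)) unit_disc"
proof -
  define L where "L \<zeta> = \<zeta> + h (exp \<zeta>)" for \<zeta>
  let ?H = "{\<zeta>. Re \<zeta> < 0}"
  have exp_in: "exp \<zeta> \<in> unit_disc" if "\<zeta> \<in> ?H" for \<zeta>
    using that by simp
  have inj: "inj_on L ?H"
  proof (rule injective_on_convex_if_Re_deriv_pos)
    show "convex ?H" by (rule convex_halfspace_Re_lt)
    fix \<zeta> assume \<zeta>: "\<zeta> \<in> ?H"
    show "(L has_field_derivative 1 + exp \<zeta> * h' (exp \<zeta>)) (at \<zeta>)"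
      unfolding L_def
      by (auto intro!: derivative_eq_intros DERIV_chain2[where g = exp, OF h[OF exp_in[OF \<zeta>]]])
    show "0 < Re (1 + exp \<zeta> * h' (exp \<zeta>))"
      by (rule pos[OF exp_in[OF \<zeta>]])
  qed
  show ?thesis
  proof (rule inj_onI)
    fix z w assume z: "z \<in> unit_disc" and w: "w \<in> unit_disc" and eq: "z * exp (h z) = w * exp (h w)"
    show "z = w"
    proof (cases "z = 0 \<or> w = 0")
      case True
      then show ?thesis using eq by auto
    next
      case False
      then have zw: "exp (Ln z) = z" "exp (Ln w) = w" by auto
      have "exp (L (Ln z)) = exp (L (Ln w))"
        unfolding L_def exp_add using zw eq by simp
      then obtain n :: int where n: "L (Ln z) = L (Ln w) + of_real (of_int (2 * n) * pi) * \<i>"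
        unfolding exp_eq by blast
      define \<eta> where "\<eta> = Ln w + of_real (of_int (2 * n) * pi) * \<i>"
      have \<eta>: "exp \<eta> = exp (Ln w)"
        unfolding \<eta>_def exp_eq by blast
      have "L \<eta> = L (Ln z)"
        unfolding n by (simp add: L_def \<eta>) (simp add: \<eta>_def)
      moreover have "\<eta> \<in> ?H" "Ln z \<in> ?H"
        using z w False by (auto simp: \<eta>_def)
      ultimately have "\<eta> = Ln z"
        using inj by (auto dest: inj_onD)
      then show ?thesis using \<eta> zw by simp
    qed
  qed
qed

text \<open>The function is \<open>z exp (h z)\<close>, where \<open>h\<close> is the primitive of \<open>(lune (\<omega> z) - 1) / z\<close> with
  \<open>h 0 = 0\<close>; it is univalent because the lune lies in the right half-plane.\<close>

lemma lune_starlike_exists: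
  assumes \<omega>: "schwarz_function \<omega>"
  obtains f where "f \<in> lune_starlike" "lune_corresponds f \<omega>"
proof -
  define p where "p z = lune (\<omega> z)" for z
  have \<omega>': "\<omega> holomorphic_on unit_disc" "\<omega> 0 = 0" "\<And>z. z \<in> unit_disc \<Longrightarrow> cmod (\<omega> z) < 1"
    using assms by (auto simp: schwarz_function_def)
  have "p holomorphic_on unit_disc"
    unfolding p_def using \<omega>'
    by (intro holomorphic_on_compose_gen[OF \<omega>'(1) holomorphic_on_lune, unfolded o_def]) auto
  then have "(\<lambda>z. p z - 1) holomorphic_on unit_disc"
    by (intro holomorphic_intros)
  then obtain g where g: "g holomorphic_on unit_disc" "\<And>z. p z - 1 = z * g z"
    by (rule holomorphic_factor_zero) (use \<omega>' in \<open>auto simp: p_def\<close>)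
  obtain h0 where h0: "\<And>z. z \<in> unit_disc \<Longrightarrow> (h0 has_field_derivative g z) (at z within unit_disc)"
    by (rule holomorphic_convex_primitive'[OF _ _ g(1)]) auto
  define h where "h z = h0 z - h0 0" for z
  have h: "(h has_field_derivative g z) (at z)" if "z \<in> unit_disc" for z
    using h0[OF that] that unfolding h_def
    by (auto simp: at_within_open[OF that] intro!: derivative_eq_intros)
  define f where "f z = z * exp (h z)" for z
  have p: "p z = 1 + z * g z" for z
    using g(2)[of z] by (simp add: algebra_simps)
  have f': "(f has_field_derivative exp (h z) * p z) (at z)" if "z \<in> unit_disc" for z
    unfolding f_def p using h[OF that] by (auto intro!: derivative_eq_intros simp: algebra_simps)
  have "inj_on f unit_disc"
    unfolding f_def
  proof (rule starlike_imp_inj_on[OF h])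
    fix z assume "z \<in> unit_disc"
    then show "0 < Re (1 + z * g z)"
      unfolding p[symmetric] p_def by (intro Re_lune_pos \<omega>')
  qed
  moreover have "f holomorphic_on unit_disc"
    unfolding holomorphic_on_open[OF open_ball] using f' by blast
  then have "f \<in> class_A"
    using DERIV_imp_deriv[OF f'[of 0]] by (auto simp: class_A_def f_def h_def p_def \<omega>')
  moreover have corr: "lune_corresponds f \<omega>"
    unfolding lune_corresponds_def
  proof (intro conjI \<omega> ballI)
    fix z assume z: "z \<in> unit_disc"
    show "starlike_quotient f z = lune (\<omega> z)"
      using DERIV_imp_deriv[OF f'[OF z]] \<omega>'
      by (auto simp: starlike_quotient_def f_def p_def)
  qed
  ultimately have "f \<in> lune_starlike"
    using \<omega> by (auto simp: lune_starlike_def class_S_def subordinate_def lune_corresponds_def)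
  then show ?thesis using corr that by blast
qed

text \<open>The quotient of two solutions of the differential equation has derivative zero off the origin,
  and it extends continuously to the origin with value one.\<close>

lemma lune_corresponds_unique:
  assumes f: "f \<in> class_A" "lune_corresponds f \<omega>" and g: "g \<in> class_A" "lune_corresponds g \<omega>"
    and z: "z \<in> unit_disc"
  shows "g z = f z"
proof -
  have hol: "f holomorphic_on unit_disc" "f 0 = 0" "g holomorphic_on unit_disc" "g 0 = 0"
    "deriv f 0 = 1" "deriv g 0 = 1"
    using f g by (auto simp: class_A_def)
  have nz: "f z \<noteq> 0" if "z \<in> unit_disc" "z \<noteq> 0" for z
  proof
    assume "f z = 0"
    moreover have "starlike_quotient f z = lune (\<omega> z)" and "cmod (\<omega> z) < 1"
      using f(2) that unfolding lune_corresponds_def schwarz_function_def by blast+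
    ultimately show False
      using that Re_lune_pos[of "\<omega> z"] by (simp add: starlike_quotient_def)
  qed
  obtain F where F: "F holomorphic_on unit_disc" "\<And>z. f z = z * F z" "F 0 = 1"
    using holomorphic_factor_zero[OF hol(1,2)] hol by metis
  obtain G where G: "G holomorphic_on unit_disc" "\<And>z. g z = z * G z" "G 0 = 1"
    using holomorphic_factor_zero[OF hol(3,4)] hol by metis
  have Fnz: "F z \<noteq> 0" if "z \<in> unit_disc" for z
    using nz[OF that] F(2)[of z] F(3) by (cases "z = 0") auto
  let ?Q = "\<lambda>z. G z / F z"
  obtain c where c: "\<And>z. z \<in> unit_disc \<Longrightarrow> ?Q z = c"
  proof (rule DERIV_zero_connected_constant[of unit_disc "{0}" ?Q])
    show "continuous_on unit_disc ?Q"
      using F G Fnz by (intro continuous_intros holomorphic_on_imp_continuous_on) auto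
    show "\<forall>z\<in>unit_disc - {0}. (?Q has_field_derivative 0) (at z)"
    proof
      fix z assume z: "z \<in> unit_disc - {0}"
      have df: "(f has_field_derivative deriv f z) (at z)" and dg: "(g has_field_derivative deriv g z) (at z)"
        using z hol by (auto intro!: holomorphic_derivI[of _ unit_disc])
      have "z * deriv f z = f z * lune (\<omega> z)" "z * deriv g z = g z * lune (\<omega> z)"
        using z starlike_equation f g by auto
      moreover have "z * (deriv g z * f z - g z * deriv f z) =
          f z * (z * deriv g z) - g z * (z * deriv f z)"
        by (simp add: algebra_simps)
      ultimately have "z * (deriv g z * f z - g z * deriv f z) = 0"
        by simp
      then have 0: "deriv g z * f z - g z * deriv f z = 0" using z by simp
      have "((\<lambda>z. g z / f z) has_field_derivative (deriv g z * f z - g z * deriv f z) / (f z * f z)) (at z)"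
        using nz z by (intro DERIV_divide df dg) auto
      then have "((\<lambda>z. g z / f z) has_field_derivative 0) (at z)"
        by (simp add: 0)
      then show "(?Q has_field_derivative 0) (at z)"
        by (rule has_field_derivative_transform_within_open[of _ _ _ "- {0}"]) (use z F(2) G(2) in auto)
    qed
  qed auto
  have "c = 1" using c[of 0] F G by simp
  then show ?thesis using c[OF z] Fnz[OF z] F(2)[of z] G(2)[of z] by simp
qed

section \<open>The extremal Schwarz functions and the sharp bounds\<close>

lemma schwarz_function_square: "schwarz_function (\<lambda>z. z\<^sup>2)"
  by (auto simp: schwarz_function_def norm_power abs_square_less_1 intro!: holomorphic_intros)

lemma schwarz_function_blaschke:
  fixes c :: complex
  assumes "cmod c < 1"
  shows "schwarz_function (\<lambda>z. z * ((c + z) / (1 + cnj c * z)))"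
proof -
  have M: "Moebius_function 0 (- c) z = (c + z) / (1 + cnj c * z)" for z
    by (simp add: Moebius_function_simple add.commute)
  have "Moebius_function 0 (- c) holomorphic_on unit_disc"
    using assms by (intro Moebius_function_holomorphic) simp
  then have "(\<lambda>z. z * Moebius_function 0 (- c) z) holomorphic_on unit_disc"
    by (intro holomorphic_intros)
  moreover have "cmod (z * Moebius_function 0 (- c) z) < 1" if "cmod z < 1" for z
  proof -
    have "cmod (Moebius_function 0 (- c) z) < 1"
      using assms that by (intro Moebius_function_norm_lt_1) auto
    then show ?thesis
      using mult_strict_mono'[OF that] by (simp add: norm_mult)
  qed
  ultimately show ?thesis
    by (simp add: schwarz_function_def M)
qed

text \<open>Read off from the equation obtained by clearing the denominator.\<close>

lemma blaschke_coefficients: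
  fixes c :: complex
  assumes "cmod c < 1" "(\<lambda>z. z * ((c + z) / (1 + cnj c * z))) has_fps_expansion W"
  shows "W $ 1 = c" "W $ 2 = 1 - cnj c * c" "W $ 3 = - cnj c * (1 - cnj c * c)"
proof -
  have nz: "1 + cnj c * z \<noteq> 0" if "z \<in> unit_disc" for z
  proof
    assume "1 + cnj c * z = 0"
    then have "cmod (cnj c * z) = 1"
      by (metis add_eq_0_iff norm_minus_cancel norm_one)
    moreover have "cmod (cnj c * z) < 1"
      using mult_strict_mono'[OF assms(1), of "cmod z" 1] that by (simp add: norm_mult)
    ultimately show False by simp
  qed
  have "W * (1 + fps_const (cnj c) * fps_X) = fps_X * (fps_const c + fps_X)"
  proof (rule has_fps_expansion_unique_disc)
    show "(\<lambda>z. z * ((c + z) / (1 + cnj c * z)) * (1 + cnj c * z))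
        has_fps_expansion W * (1 + fps_const (cnj c) * fps_X)"
      by (intro fps_expansion_intros assms)
    show "(\<lambda>z. z * (c + z)) has_fps_expansion fps_X * (fps_const c + fps_X)"
      by (intro fps_expansion_intros)
  qed (use nz in simp)
  then have eq: "fps_nth (W * (1 + fps_const (cnj c) * fps_X)) n =
      fps_nth (fps_X * (fps_const c + fps_X)) n" for n
    by simp
  have W0: "W $ 0 = 0" using eq[of 0] by simp
  show W1: "W $ 1 = c" using eq[of 1] W0 by simp
  have W2': "W $ 2 + cnj c * W $ 1 = 1"
    using eq[of 2] W0 by (simp add: fps_mult_nth_2 algebra_simps)
  show W2: "W $ 2 = 1 - cnj c * c"
    using W2' unfolding W1 by (simp add: algebra_simps)
  have "W $ 3 + cnj c * W $ 2 = 0"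
    using eq[of 3] W0 by (simp add: fps_mult_nth_3 algebra_simps)
  then show "W $ 3 = - cnj c * (1 - cnj c * c)"
    unfolding W2 by (simp add: add_eq_0_iff2)
qed

theorem theorem3p1:
  "(\<forall>f\<in>lune_starlike.
      norm (schippers 3 f 0) \<le> 3 \<and> norm (schippers 4 f 0) \<le> 16 * sqrt (2 / 7)) \<and>
   (let \<omega> = (\<lambda>z. z\<^sup>2)
    in \<exists>f\<^sub>1\<in>lune_starlike. lune_corresponds f\<^sub>1 \<omega> \<and>
         (\<forall>g\<in>class_A. lune_corresponds g \<omega> \<longrightarrow> (\<forall>z\<in>unit_disc. g z = f\<^sub>1 z)) \<and>
         norm (schippers 3 f\<^sub>1 0) = 3) \<and>
   (let c = complex_of_real (sqrt (2 / 7)); \<omega> = (\<lambda>z. z * ((c + z) / (1 + c * z)))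
    in \<exists>f\<^sub>2\<in>lune_starlike. lune_corresponds f\<^sub>2 \<omega> \<and>
         (\<forall>g\<in>class_A. lune_corresponds g \<omega> \<longrightarrow> (\<forall>z\<in>unit_disc. g z = f\<^sub>2 z)) \<and>
         norm (schippers 4 f\<^sub>2 0) = 16 * sqrt (2 / 7))"
proof (intro conjI ballI)
  fix f assume f: "f \<in> lune_starlike"
  then obtain \<omega> where A: "f \<in> class_A" and c: "lune_corresponds f \<omega>"
    by (auto simp: lune_starlike_def class_S_def subordinate_def lune_corresponds_def)
  then have \<omega>: "schwarz_function \<omega>" by (simp add: lune_corresponds_def)
  define W where "W = fps_expansion \<omega> 0"
  have W: "\<omega> has_fps_expansion W"
    using \<omega> unfolding W_def by (intro holomorphic_disc_has_fps_expansion) (simp add: schwarz_function_def)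
  show "norm (schippers 3 f 0) \<le> 3"
    using schwarz_second_coefficient_bound[OF \<omega> W]
    unfolding schippers_lune_corresponds[OF A c W] norm_mult by simp
  show "norm (schippers 4 f 0) \<le> 16 * sqrt (2 / 7)"
    using schwarz_third_coefficient_bound[OF \<omega> W]
    unfolding schippers_lune_corresponds[OF A c W] norm_mult by simp
next
  obtain f where f: "f \<in> lune_starlike" "lune_corresponds f (\<lambda>z. z\<^sup>2)"
    using lune_starlike_exists[OF schwarz_function_square] .
  then have A: "f \<in> class_A" by (simp add: lune_starlike_def class_S_def)
  have W: "(\<lambda>z. z\<^sup>2) has_fps_expansion (fps_X ^ 2 :: complex fps)"
    by (intro fps_expansion_intros)
  have "norm (schippers 3 f 0) = 3"
    unfolding schippers_lune_corresponds(1)[OF A f(2) W] by (simp add: fps_X_power_nth)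
  then show "let \<omega> = (\<lambda>z. z\<^sup>2)
    in \<exists>f\<^sub>1\<in>lune_starlike. lune_corresponds f\<^sub>1 \<omega> \<and>
         (\<forall>g\<in>class_A. lune_corresponds g \<omega> \<longrightarrow> (\<forall>z\<in>unit_disc. g z = f\<^sub>1 z)) \<and>
         norm (schippers 3 f\<^sub>1 0) = 3"
    unfolding Let_def using f lune_corresponds_unique[OF A f(2)] by blast
next
  define s c where "s = sqrt (2 / 7)" and "c = complex_of_real s"
  let ?\<omega> = "\<lambda>z. z * ((c + z) / (1 + c * z))"
  have s: "0 \<le> s" "s < 1" "s\<^sup>2 = 2 / 7"
    by (auto simp: s_def)
  have c: "cmod c < 1" "cnj c = c" using s by (simp_all add: c_def)
  have "c\<^sup>2 = of_real (s\<^sup>2)" by (simp add: c_def)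
  then have c2: "c\<^sup>2 = 2 / 7" unfolding s(3) by simp
  have \<omega>: "schwarz_function ?\<omega>"
    using schwarz_function_blaschke[OF c(1)] c(2) by simp
  obtain f where f: "f \<in> lune_starlike" "lune_corresponds f ?\<omega>"
    using lune_starlike_exists[OF \<omega>] .
  then have A: "f \<in> class_A" by (simp add: lune_starlike_def class_S_def)
  define W where "W = fps_expansion ?\<omega> 0"
  have W: "?\<omega> has_fps_expansion W"
    using \<omega> unfolding W_def by (intro holomorphic_disc_has_fps_expansion) (simp add: schwarz_function_def)
  have Wn: "W $ 1 = c" "W $ 2 = 1 - c\<^sup>2" "W $ 3 = - c * (1 - c\<^sup>2)"
    using blaschke_coefficients[OF c(1), of W] W unfolding c(2) by (simp_all add: power2_eq_square)
  have "W $ 3 - 2 * W $ 1 * W $ 2 + (W $ 1) ^ 3 / 2 = c * (7 / 2 * c\<^sup>2 - 3)"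
    unfolding Wn by (simp add: power2_eq_square power3_eq_cube field_simps)
  also have "\<dots> = - 2 * c"
    unfolding c2 by simp
  finally have "norm (schippers 4 f 0) = 16 * s"
    unfolding schippers_lune_corresponds(2)[OF A f(2) W] using s(1) by (simp add: c_def norm_mult)
  then show "let c = complex_of_real (sqrt (2 / 7)); \<omega> = (\<lambda>z. z * ((c + z) / (1 + c * z)))
    in \<exists>f\<^sub>2\<in>lune_starlike. lune_corresponds f\<^sub>2 \<omega> \<and>
         (\<forall>g\<in>class_A. lune_corresponds g \<omega> \<longrightarrow> (\<forall>z\<in>unit_disc. g z = f\<^sub>2 z)) \<and>
         norm (schippers 4 f\<^sub>2 0) = 16 * sqrt (2 / 7)"
    unfolding Let_def s_def[symmetric] c_def[symmetric]
    using f lune_corresponds_unique[OF A f(2)] by blast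
qed

end
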